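(* Let $n\ge 1$ and let $G\leq\mathfrak{S}_n$ be a permutation group. Let $T_G=\frac{1}{|G|}\sum_{\sigma\in G}\sigma$ be the $G$-symmetrizer acting on $\mathbb{C}[z_1,\ldots,z_n]$. The following are equivalent: (1) for any multiaffine stable polynomial $f\in\mathbb{C}[z_1,\ldots,z_n]$, the polynomial $T_G(f)$ is stable; (2) the permutation group $G$ is orbit homogeneous.
   Context: $\mathfrak{S}_n$ is the symmetric group on $\{1,\ldots,n\}$. It acts on $\mathbb{C}[z_1,\ldots,z_n]$ by $\mathbb{C}$-algebra automorphisms with $\sigma(z_i)=z_{\sigma(i)}$. A polynomial is multiaffine if each variable occurs in it at most to the first power. Let $\mathcal{H}=\{z\in\mathbb{C}:\operatorname{Im} z>0\}$; a polynomial $f\in\mathbb{C}[z_1,\ldots,z_n]$ is stable if $f(\zeta_1,\ldots,\zeta_n)\neq 0$ for all $(\zeta_1,\ldots,\zeta_n)\in\mathcal{H}^n$ (so the zero polynomial is not stable). Let $S_1,\ldots,S_r$ be the orbits of $G$ acting on $\{1,\ldots,n\}$. The group $G$ is orbit homogeneous if for any two subsets $A,B\subseteq\{1,\ldots,n\}$ with $|A\cap S_i|=|B\cap S_i|$ for each $1\leq i\leq r$ there is a $\sigma\in G$ such that $\{\sigma(a): a\in A\}=B$. *)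

theory Defs
  imports Complex_Main "HOL-Library.Poly_Mapping"
    "HOL-Algebra.Sym_Groups" "HOL-Algebra.Group_Action"
begin

text \<open>A monomial is the finitely supported map of its exponents, and a polynomial is the
  finitely supported map of its coefficients; the multiplication of
  \<^typ>\<open>'a \<Rightarrow>\<^sub>0 'b\<close> is convolution. The variables are indexed by all natural
  numbers, and \<open>mpolys n\<close> is \<open>\<complex>[z\<^sub>1, \<dots>, z\<^sub>n]\<close>.\<close>

type_synonym monomial = "nat \<Rightarrow>\<^sub>0 nat"
type_synonym mpoly = "monomial \<Rightarrow>\<^sub>0 complex"

definition mconst :: "complex \<Rightarrow> mpoly" where
  "mconst c = Poly_Mapping.single 0 c"

definition mvar :: "nat \<Rightarrow> mpoly" where
  "mvar i = Poly_Mapping.single (Poly_Mapping.single i 1) 1"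

definition mpolys :: "nat \<Rightarrow> mpoly set" where
  "mpolys n = {f. \<forall>m \<in> Poly_Mapping.keys f. Poly_Mapping.keys m \<subseteq> {1..n}}"

text \<open>For a ring homomorphism \<open>h\<close>, this is the ring homomorphism that is \<open>h\<close> on
  constants and sends the \<open>i\<close>-th variable to \<open>x i\<close>.\<close>

definition msubst :: "(complex \<Rightarrow> 'a::comm_ring_1) \<Rightarrow> (nat \<Rightarrow> 'a) \<Rightarrow> mpoly \<Rightarrow> 'a" where
  "msubst h x f = (\<Sum>m \<in> Poly_Mapping.keys f. h (Poly_Mapping.lookup f m) *
      (\<Prod>i \<in> Poly_Mapping.keys m. x i ^ Poly_Mapping.lookup m i))"

definition meval :: "(nat \<Rightarrow> complex) \<Rightarrow> mpoly \<Rightarrow> complex" where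
  "meval \<zeta> f = msubst (\<lambda>c. c) \<zeta> f"

definition perm_act :: "(nat \<Rightarrow> nat) \<Rightarrow> mpoly \<Rightarrow> mpoly" where
  "perm_act \<sigma> f = msubst mconst (\<lambda>i. mvar (\<sigma> i)) f"

definition symmetrizer :: "(nat \<Rightarrow> nat) set \<Rightarrow> mpoly \<Rightarrow> mpoly" where
  "symmetrizer G f = mconst (1 / of_nat (card G)) * (\<Sum>\<sigma>\<in>G. perm_act \<sigma> f)"

definition multiaffine :: "mpoly \<Rightarrow> bool" where
  "multiaffine f \<longleftrightarrow> (\<forall>m \<in> Poly_Mapping.keys f. \<forall>i. Poly_Mapping.lookup m i \<le> 1)"

definition stable_poly :: "nat \<Rightarrow> mpoly \<Rightarrow> bool" where
  "stable_poly n f \<longleftrightarrow> (\<forall>\<zeta>. (\<forall>i\<in>{1..n}. Im (\<zeta> i) > 0) \<longrightarrow> meval \<zeta> f \<noteq> 0)"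

definition orbit_homogeneous :: "nat \<Rightarrow> (nat \<Rightarrow> nat) set \<Rightarrow> bool" where
  "orbit_homogeneous n G \<longleftrightarrow>
    (\<forall>A B. A \<subseteq> {1..n} \<longrightarrow> B \<subseteq> {1..n} \<longrightarrow>
      (\<forall>S \<in> orbits (sym_group n\<lparr>carrier := G\<rparr>) {1..n} (\<lambda>\<sigma>. \<sigma>). card (A \<inter> S) = card (B \<inter> S)) \<longrightarrow>
      (\<exists>\<sigma>\<in>G. \<sigma> ` A = B))"

end

theory Submission
  imports Defs "HOL-Computational_Algebra.Fundamental_Theorem_Algebra"
begin

text \<open>If \<open>G\<close> is orbit homogeneous, then \<open>symmetrizer G f\<close> is symmetric in the variables of each
  orbit. By the Grace--Walsh--Szego theorem, applied to one orbit after the other, it vanishes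
  somewhere in the product of upper half-planes only if it does so at a point that is constant on
  the orbits; but there it agrees with \<open>f\<close>.

  For the converse only monomials are needed: the images of a set \<open>A\<close> under \<open>G\<close> form the support
  of a stable polynomial and therefore satisfy the basis exchange property of matroids. By
  induction on the cardinality it suffices to connect \<open>C \<union> {a}\<close> and \<open>C \<union> {b}\<close> for
  \<open>a\<close>, \<open>b\<close> in one orbit. Write \<open>C = U \<union> {c}\<close>. A permutation in \<open>G\<close> maps \<open>U \<union> {a}\<close> to
  \<open>U \<union> {b}\<close>. If \<open>C \<union> {a}\<close> and \<open>C \<union> {b}\<close> had different \<open>G\<close>-orbits, then exchange would put
  \<open>U \<union> {a, b}\<close> into the first orbit, and by symmetry also into the second.\<close>

declare One_nat_def [simp del]

section \<open>The Grace--Walsh--Szego theorem\<close>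

text \<open>The Moebius map sending \<eta> to \<open>1 / (\<xi> - \<eta>)\<close> has its pole in
  the upper half-plane, so it carries the closed lower half-plane into a disc. The centre is
  \<open>- \<i> / (2 * Im \<xi>)\<close>, and 0, the image of infinity, lies on the boundary
  circle.\<close>

lemma norm_inverse_diff_plus_le_iff:
  fixes \<xi> \<eta> :: complex
  assumes "Im \<xi> > 0" "\<eta> \<noteq> \<xi>"
  shows "norm (1 / (\<xi> - \<eta>) + \<i> / (2 * Im \<xi>)) \<le> 1 / (2 * Im \<xi>) \<longleftrightarrow> Im \<eta> \<le> 0"
proof -
  define y where "y = Im \<xi>"
  have y: "y > 0" using assms by (simp add: y_def)
  have "1 / (\<xi> - \<eta>) + \<i> / (2 * y) = (2 * y + \<i> * (\<xi> - \<eta>)) / (2 * y * (\<xi> - \<eta>))"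
    using y assms by (simp add: field_simps)
  then have "norm (1 / (\<xi> - \<eta>) + \<i> / (2 * y)) = norm (2 * y + \<i> * (\<xi> - \<eta>)) / (2 * y * norm (\<xi> - \<eta>))"
    using y by (simp add: norm_divide norm_mult)
  moreover have "N / (2 * y * d) \<le> 1 / (2 * y) \<longleftrightarrow> N \<le> d" if "d > 0" for N d
    using y that by (simp add: field_simps)
  ultimately have "norm (1 / (\<xi> - \<eta>) + \<i> / (2 * y)) \<le> 1 / (2 * y) \<longleftrightarrow> norm (2 * y + \<i> * (\<xi> - \<eta>)) \<le> norm (\<xi> - \<eta>)"
    using assms by simp
  also have "\<dots> \<longleftrightarrow> (norm (2 * y + \<i> * (\<xi> - \<eta>)))\<^sup>2 \<le> (norm (\<xi> - \<eta>))\<^sup>2"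
    by simp
  \<comment> \<open>The left square exceeds the right one by
    \<open>4 * y * Im \<eta>\<close>.\<close>
  also have "\<dots> \<longleftrightarrow> y * Im \<eta> \<le> 0"
    by (simp add: cmod_power2 y_def) (simp add: power2_eq_square algebra_simps)
  also have "\<dots> \<longleftrightarrow> Im \<eta> \<le> 0" using y by (simp add: mult_le_0_iff)
  finally show ?thesis by (simp add: y_def)
qed

text \<open>The logarithmic derivative is the sum of \<open>1 / (\<xi> - r)\<close> over the roots
  \<open>r\<close>, none of which lies in the upper half-plane, so every summand lies in the disc of
  the preceding lemma. The triangle inequality adds up the discs. The induction splits off one root
  at a time.\<close>

lemma norm_logarithmic_derivative_plus_le:
  fixes p :: "complex poly"
  assumes "degree p \<le> m" "\<And>z. Im z > 0 \<Longrightarrow> poly p z \<noteq> 0" "Im \<xi> > 0"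
  shows "norm (poly (pderiv p) \<xi> / poly p \<xi> + of_nat m * (\<i> / (2 * Im \<xi>))) \<le> m * (1 / (2 * Im \<xi>))"
  using assms(1,2)
proof (induction m arbitrary: p)
  case 0
  then have "pderiv p = 0" by (simp add: pderiv_eq_0_iff)
  then show ?case by simp
next
  case (Suc m)
  show ?case
  proof (cases "degree p \<le> m")
    case True
    from Suc.IH[OF this Suc.prems(2)]
    have 1: "norm (poly (pderiv p) \<xi> / poly p \<xi> + of_nat m * (\<i> / (2 * Im \<xi>))) \<le> m * (1 / (2 * Im \<xi>))" .
    \<comment> \<open>If the degree is below the bound, the missing root counts as a root at
      infinity; it contributes 0, which belongs to the disc.\<close>
    have 2: "norm (\<i> / (2 * Im \<xi>)) \<le> 1 / (2 * Im \<xi>)"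
      using assms(3) by (simp add: norm_divide norm_mult)
    show ?thesis
      using norm_triangle_mono[OF 1 2] by (simp only: of_nat_Suc distrib_right mult_1 ac_simps)
  next
    case False
    then have "\<not> constant (poly p)" by (simp add: constant_degree)
    then obtain r where r: "poly p r = 0" using fundamental_theorem_of_algebra by blast
    then obtain q where q: "p = [:-r, 1:] * q" by (metis dvdE poly_eq_0_iff_dvd)
    have "q \<noteq> 0" using False q by auto
    then have "degree p = Suc (degree q)" unfolding q by (subst degree_mult_eq) auto
    then have dq: "degree q \<le> m" using Suc.prems by simp
    have nq: "poly q z \<noteq> 0" if "Im z > 0" for z
      using Suc.prems(2)[OF that] by (simp add: q)
    have r0: "Im r \<le> 0" using r Suc.prems(2) not_le by blast
    then have "r \<noteq> \<xi>" using assms(3) by auto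
    have 1: "norm (poly (pderiv q) \<xi> / poly q \<xi> + of_nat m * (\<i> / (2 * Im \<xi>))) \<le> m * (1 / (2 * Im \<xi>))"
      by (rule Suc.IH[OF dq nq])
    have 2: "norm (1 / (\<xi> - r) + \<i> / (2 * Im \<xi>)) \<le> 1 / (2 * Im \<xi>)"
      using norm_inverse_diff_plus_le_iff[OF assms(3) \<open>r \<noteq> \<xi>\<close>] r0 by simp
    have "poly p \<xi> = (\<xi> - r) * poly q \<xi>" by (simp add: q algebra_simps)
    moreover have "poly (pderiv p) \<xi> = (\<xi> - r) * poly (pderiv q) \<xi> + poly q \<xi>"
      unfolding q pderiv_mult by (simp add: pderiv_pCons algebra_simps)
    ultimately have "poly (pderiv p) \<xi> / poly p \<xi> = poly (pderiv q) \<xi> / poly q \<xi> + 1 / (\<xi> - r)"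
      using nq[OF assms(3)] \<open>r \<noteq> \<xi>\<close> by (simp add: add_divide_distrib)
    then show ?thesis
      using norm_triangle_mono[OF 1 2] by (simp only: of_nat_Suc distrib_right mult_1 ac_simps)
  qed
qed

text \<open>The expression is the polar derivative of \<open>p\<close> with pole \<zeta>, taken at
  \<xi>. If it were zero, the logarithmic derivative would be \<open>m / (\<xi> - \<zeta>)\<close>,
  and the disc bound would put \<zeta> outside the upper half-plane.\<close>

theorem Laguerre_upper_half_plane:
  fixes p :: "complex poly"
  assumes "degree p \<le> m" "m > 0" "\<And>z. Im z > 0 \<Longrightarrow> poly p z \<noteq> 0" "Im \<xi> > 0" "Im \<zeta> > 0"
  shows "of_nat m * poly p \<xi> + (\<zeta> - \<xi>) * poly (pderiv p) \<xi> \<noteq> 0"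
proof
  assume *: "of_nat m * poly p \<xi> + (\<zeta> - \<xi>) * poly (pderiv p) \<xi> = 0"
  have p: "poly p \<xi> \<noteq> 0" using assms by blast
  with * have "\<zeta> \<noteq> \<xi>" using \<open>m > 0\<close> by auto
  with * p have "poly (pderiv p) \<xi> / poly p \<xi> = of_nat m * (1 / (\<xi> - \<zeta>))"
    by (simp add: divide_simps) (simp add: algebra_simps)
  with norm_logarithmic_derivative_plus_le[OF assms(1,3,4)]
  have "norm (of_nat m * (1 / (\<xi> - \<zeta>) + \<i> / (2 * Im \<xi>))) \<le> m * (1 / (2 * Im \<xi>))"
    by (simp add: algebra_simps)
  then have "norm (1 / (\<xi> - \<zeta>) + \<i> / (2 * Im \<xi>)) \<le> 1 / (2 * Im \<xi>)"
    unfolding norm_mult norm_of_nat using \<open>m > 0\<close> by (simp only: mult_le_cancel_left_pos of_nat_0_less_iff)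
  then show False
    using norm_inverse_diff_plus_le_iff[OF assms(4) \<open>\<zeta> \<noteq> \<xi>\<close>] assms(5) by simp
qed

section \<open>Separately affine functions and their restriction to a diagonal\<close>

text \<open>Being of degree at most one in a coordinate is expressed by interpolation between the
  values at 0 and 1, so that functions of points can be treated without coefficients.\<close>

definition affine_in :: "'i \<Rightarrow> (('i \<Rightarrow> complex) \<Rightarrow> complex) \<Rightarrow> bool" where
  "affine_in s h \<longleftrightarrow> (\<forall>\<zeta> w. h (\<zeta>(s := w)) = (1 - w) * h (\<zeta>(s := 0)) + w * h (\<zeta>(s := 1)))"

lemma affine_inD: "affine_in s h \<Longrightarrow> h (\<zeta>(s := w)) = (1 - w) * h (\<zeta>(s := 0)) + w * h (\<zeta>(s := 1))"
  unfolding affine_in_def by blast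

text \<open>For a function affine in \<open>s\<close>, the difference of its values at 1 and 0 is
  the partial derivative in \<open>s\<close>. The last formula is therefore the chain rule along the
  diagonal of the coordinates in \<open>S\<close>, the others being frozen at \<zeta>.\<close>

lemma diagonal_polynomial:
  fixes h :: "('i \<Rightarrow> complex) \<Rightarrow> complex"
  assumes "finite S" "\<forall>s\<in>S. affine_in s h"
  shows "\<exists>p. degree p \<le> card S \<and> (\<forall>\<xi>. poly p \<xi> = h (override_on \<zeta> (\<lambda>_. \<xi>) S)) \<and>
    (\<forall>\<xi>. poly (pderiv p) \<xi> = (\<Sum>s\<in>S. h ((override_on \<zeta> (\<lambda>_. \<xi>) S)(s := 1))
                                       - h ((override_on \<zeta> (\<lambda>_. \<xi>) S)(s := 0))))"
  using assms
proof (induction S arbitrary: \<zeta> rule: finite_induct)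
  case empty
  show ?case by (rule exI[of _ "[:h \<zeta>:]"]) (simp add: pderiv_pCons)
next
  case (insert t S)
  let ?d = "\<lambda>\<zeta> \<xi> S. override_on \<zeta> (\<lambda>_. \<xi>) S"
  have "\<forall>s\<in>S. affine_in s h" using insert.prems by blast
  note IH = insert.IH[OF this]
  obtain p0 where "degree p0 \<le> card S \<and> (\<forall>\<xi>. poly p0 \<xi> = h (?d (\<zeta>(t := 0)) \<xi> S)) \<and>
      (\<forall>\<xi>. poly (pderiv p0) \<xi> = (\<Sum>s\<in>S. h ((?d (\<zeta>(t := 0)) \<xi> S)(s := 1)) - h ((?d (\<zeta>(t := 0)) \<xi> S)(s := 0))))"
    using IH[of "\<zeta>(t := 0)"] by (rule exE)
  note p0 = this[THEN conjunct1] this[THEN conjunct2, THEN conjunct1, rule_format]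
    this[THEN conjunct2, THEN conjunct2, rule_format]

  obtain p1 where "degree p1 \<le> card S \<and> (\<forall>\<xi>. poly p1 \<xi> = h (?d (\<zeta>(t := 1)) \<xi> S)) \<and>
      (\<forall>\<xi>. poly (pderiv p1) \<xi> = (\<Sum>s\<in>S. h ((?d (\<zeta>(t := 1)) \<xi> S)(s := 1)) - h ((?d (\<zeta>(t := 1)) \<xi> S)(s := 0))))"
    using IH[of "\<zeta>(t := 1)"] by (rule exE)
  note p1 = this[THEN conjunct1] this[THEN conjunct2, THEN conjunct1, rule_format]
    this[THEN conjunct2, THEN conjunct2, rule_format]

  \<comment> \<open>Interpolation in the coordinate \<open>t\<close>, whose value is now the
    indeterminate itself; the degree bound grows by one.\<close>
  define p where "p = [:1, -1:] * p0 + [:0, 1:] * p1"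
  have t: "t \<notin> S" by fact
  have u: "?d (\<zeta>(t := w)) \<xi> S = (?d \<zeta> \<xi> (insert t S))(t := w)" for w \<xi>
    using t by (auto simp: override_on_def fun_eq_iff)
  have aff: "h (\<eta>(t := w)) = (1 - w) * h (\<eta>(t := 0)) + w * h (\<eta>(t := 1))" for \<eta> w
    using insert.prems by (intro affine_inD) auto
  have deg: "degree ([:a, b:] * q) \<le> Suc (card S)" if "degree q \<le> card S" for a b and q :: "complex poly"
    using degree_mult_le[of "[:a, b:]" q] that by (auto split: if_splits)
  have "degree p \<le> card (insert t S)"
    unfolding p_def card_insert_disjoint[OF insert(1,2)] by (intro degree_add_le deg p0 p1)
  moreover have "poly p \<xi> = h (?d \<zeta> \<xi> (insert t S))" for \<xi>
  proof -
    have "poly p \<xi> = (1 - \<xi>) * h ((?d \<zeta> \<xi> (insert t S))(t := 0)) + \<xi> * h ((?d \<zeta> \<xi> (insert t S))(t := 1))"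
      by (simp add: p_def p0 p1 u algebra_simps)
    also have "\<dots> = h ((?d \<zeta> \<xi> (insert t S))(t := \<xi>))" by (rule aff[symmetric])
    also have "(?d \<zeta> \<xi> (insert t S))(t := \<xi>) = ?d \<zeta> \<xi> (insert t S)"
      by (auto simp: override_on_def fun_eq_iff)
    finally show ?thesis .
  qed
  moreover have "poly (pderiv p) \<xi> = (\<Sum>s\<in>insert t S. h ((?d \<zeta> \<xi> (insert t S))(s := 1))
                                       - h ((?d \<zeta> \<xi> (insert t S))(s := 0)))" for \<xi>
  proof -
    let ?D = "?d \<zeta> \<xi> (insert t S)"
    \<comment> \<open>Since \<open>?D\<close> has the value \<xi> at \<open>t\<close>, interpolating
      in \<open>t\<close> with weight \<xi> gives back the value at
      \<open>?D(s := w)\<close>.\<close>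
    have 1: "(1 - \<xi>) * h (?D(t := 0, s := w)) + \<xi> * h (?D(t := 1, s := w)) = h (?D(s := w))" if "s \<in> S" for s w
    proof -
      have tw: "?D(t := v, s := w) = ?D(s := w, t := v)" for v
        using that t by (intro fun_upd_twist) auto
      have "?D(s := w) = (?D(s := w))(t := \<xi>)"
        using that t by (auto simp: override_on_def fun_eq_iff)
      then have "h (?D(s := w)) = h ((?D(s := w))(t := \<xi>))" by (rule arg_cong)
      also have "\<dots> = (1 - \<xi>) * h (?D(s := w, t := 0)) + \<xi> * h (?D(s := w, t := 1))"
        by (rule aff)
      finally show ?thesis unfolding tw by (rule sym)
    qed
    have "poly (pderiv p) \<xi> = (1 - \<xi>) * poly (pderiv p0) \<xi> + \<xi> * poly (pderiv p1) \<xi>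
        + (h (?D(t := 1)) - h (?D(t := 0)))"
      unfolding p_def pderiv_add pderiv_mult
      by (simp add: pderiv_pCons p0(2) p1(2) u algebra_simps)
    also have "(1 - \<xi>) * poly (pderiv p0) \<xi> + \<xi> * poly (pderiv p1) \<xi>
       = (\<Sum>s\<in>S. ((1 - \<xi>) * h (?D(t := 0, s := 1)) + \<xi> * h (?D(t := 1, s := 1)))
               - ((1 - \<xi>) * h (?D(t := 0, s := 0)) + \<xi> * h (?D(t := 1, s := 0))))"
      unfolding p0 p1 u sum_distrib_left sum.distrib[symmetric]
      by (intro sum.cong refl) (simp add: algebra_simps)
    also have "\<dots> = (\<Sum>s\<in>S. h (?D(s := 1)) - h (?D(s := 0)))"
      by (intro sum.cong refl) (simp only: 1)
    finally show ?thesis by (subst sum.insert[OF insert(1,2)], subst add.commute)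
  qed
  ultimately have "degree p \<le> card (insert t S) \<and> (\<forall>\<xi>. poly p \<xi> = h (?d \<zeta> \<xi> (insert t S))) \<and>
    (\<forall>\<xi>. poly (pderiv p) \<xi> = (\<Sum>s\<in>insert t S. h ((?d \<zeta> \<xi> (insert t S))(s := 1))
                                       - h ((?d \<zeta> \<xi> (insert t S))(s := 0))))"
    by simp
  then show ?case by (rule exI)
qed

text \<open>Since \<open>h\<close> is symmetric, the
  derivative of the diagonal polynomial is \<open>card S\<close> times any partial derivative, so
  Laguerre's theorem moves one coordinate at a time off the diagonal.\<close>

theorem Grace_Walsh_Szego_upper_half_plane:
  fixes h :: "('i \<Rightarrow> complex) \<Rightarrow> complex"
  assumes "finite S" "\<forall>s\<in>S. affine_in s h"
    and "\<And>s t \<zeta>. s \<in> S \<Longrightarrow> t \<in> S \<Longrightarrow> h (\<zeta> \<circ> transpose s t) = h \<zeta>"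
    and "\<And>\<xi>. Im \<xi> > 0 \<Longrightarrow> h (override_on \<zeta> (\<lambda>_. \<xi>) S) \<noteq> 0"
    and "\<And>s. s \<in> S \<Longrightarrow> Im (\<zeta> s) > 0"
  shows "h \<zeta> \<noteq> 0"
  using assms
proof (induction S arbitrary: \<zeta> rule: finite_induct)
  case empty
  show ?case using empty(3)[of \<i>] by simp
next
  case (insert t S)
  show ?case
  proof (rule insert.IH)
    \<comment> \<open>The induction hypothesis for \<open>S\<close> leaves the coordinate
      \<open>t\<close> at \<open>\<zeta> t\<close>. It asks for nonvanishing at points where
      \<open>S\<close> is on the diagonal and \<open>t\<close> is not, whereas the assumption has
      \<open>t\<close> on the diagonal too.\<close>
    fix \<xi> :: complex assume \<xi>: "Im \<xi> > 0"
    let ?D = "override_on \<zeta> (\<lambda>_. \<xi>) (insert t S)"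
    obtain p where "degree p \<le> card (insert t S) \<and> (\<forall>\<xi>. poly p \<xi> = h (override_on \<zeta> (\<lambda>_. \<xi>) (insert t S))) \<and>
      (\<forall>\<xi>. poly (pderiv p) \<xi> = (\<Sum>s\<in>insert t S. h ((override_on \<zeta> (\<lambda>_. \<xi>) (insert t S))(s := 1)) - h ((override_on \<zeta> (\<lambda>_. \<xi>) (insert t S))(s := 0))))"
      using diagonal_polynomial[of "insert t S" h \<zeta>, OF finite.insertI[OF insert.hyps(1)] insert.prems(1)]
      by (rule exE)
    note p = this[THEN conjunct1] this[THEN conjunct2, THEN conjunct1, rule_format]
      this[THEN conjunct2, THEN conjunct2, rule_format]

    have sym: "h (?D(s := w)) = h (?D(t := w))" if "s \<in> insert t S" for s w
    proof -
      have "?D(s := w) = ?D(t := w) \<circ> transpose s t"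
        using that by (auto simp: override_on_def fun_eq_iff transpose_def)
      then show ?thesis using insert.prems(2)[OF that, of t] by (simp only: insertI1)
    qed
    define c where "c = (of_nat (card (insert t S)) :: complex)"
    have c: "c \<noteq> 0" using insert.hyps by (simp add: c_def del: of_nat_Suc)
    \<comment> \<open>Laguerre's theorem for the diagonal polynomial, with pole at the target value
      \<open>\<zeta> t\<close> of the coordinate \<open>t\<close>.\<close>
    have "c * poly p \<xi> + (\<zeta> t - \<xi>) * poly (pderiv p) \<xi> \<noteq> 0"
      unfolding c_def
      by (rule Laguerre_upper_half_plane[OF p(1)]) (use insert.hyps(1) insert.prems(3,4) \<xi> p(2) in \<open>auto simp: card_gt_0_iff\<close>)
    moreover have "poly (pderiv p) \<xi> = c * (h (?D(t := 1)) - h (?D(t := 0)))"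
      unfolding p(3) c_def sum_constant[symmetric] by (intro sum.cong refl) (simp only: sym)
    ultimately have "c * (poly p \<xi> + (\<zeta> t - \<xi>) * (h (?D(t := 1)) - h (?D(t := 0)))) \<noteq> 0"
      by (simp add: algebra_simps)
    then have ne: "poly p \<xi> + (\<zeta> t - \<xi>) * (h (?D(t := 1)) - h (?D(t := 0))) \<noteq> 0"
      using c by simp
    have aff: "h (?D(t := w)) = (1 - w) * h (?D(t := 0)) + w * h (?D(t := 1))" for w
      using insert.prems(1) by (intro affine_inD) auto
    have "poly p \<xi> = h (?D(t := \<xi>))"
      unfolding p(2) by (intro arg_cong[of _ _ h]) (auto simp: override_on_def)
    \<comment> \<open>By affinity the first-order expansion in \<open>t\<close> around \<xi> is
      exact; it is the polar derivative divided by \<open>c\<close>.\<close>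
    then have "h (?D(t := \<zeta> t)) = poly p \<xi> + (\<zeta> t - \<xi>) * (h (?D(t := 1)) - h (?D(t := 0)))"
      by (simp only: aff[of \<xi>] aff[of "\<zeta> t"]) (simp add: algebra_simps)
    with ne have "h (?D(t := \<zeta> t)) \<noteq> 0" by simp
    moreover have "?D(t := \<zeta> t) = override_on \<zeta> (\<lambda>_. \<xi>) S"
      using insert.hyps by (auto simp: override_on_def)
    ultimately show "h (override_on \<zeta> (\<lambda>_. \<xi>) S) \<noteq> 0" by simp
  next
    show "\<forall>s\<in>S. affine_in s h" using insert.prems(1) by blast
    show "h (\<zeta> \<circ> transpose s t) = h \<zeta>" if "s \<in> S" "t \<in> S" for s t \<zeta>
      using insert.prems(2) that by blast
    show "Im (\<zeta> s) > 0" if "s \<in> S" for s using insert.prems(4) that by blast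
  qed
qed

section \<open>Evaluation of polynomials and of the symmetrizer\<close>

lemma prod_keys_power_superset:
  fixes x :: "nat \<Rightarrow> 'a::comm_ring_1" and m :: monomial
  assumes "finite A" "Poly_Mapping.keys m \<subseteq> A"
  shows "(\<Prod>i \<in> Poly_Mapping.keys m. x i ^ Poly_Mapping.lookup m i) = (\<Prod>i\<in>A. x i ^ Poly_Mapping.lookup m i)"
  using assms by (intro prod.mono_neutral_left) (auto simp: in_keys_iff)

text \<open>Provides a common index set for several polynomials, needed because terms of a sum may
  cancel.\<close>

lemma meval_superset:
  assumes "finite A" "Poly_Mapping.keys f \<subseteq> A"
  shows "meval \<zeta> f = (\<Sum>m\<in>A. Poly_Mapping.lookup f m *
      (\<Prod>i \<in> Poly_Mapping.keys m. \<zeta> i ^ Poly_Mapping.lookup m i))"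
  unfolding meval_def msubst_def using assms by (intro sum.mono_neutral_left) (auto simp: in_keys_iff)

lemma meval_add: "meval \<zeta> (f + g) = meval \<zeta> f + meval \<zeta> g"
proof -
  let ?A = "Poly_Mapping.keys f \<union> Poly_Mapping.keys g"
  have "Poly_Mapping.keys (f + g) \<subseteq> ?A" by (rule keys_add)
  then show ?thesis
    by (simp add: meval_superset[of ?A] lookup_add sum.distrib algebra_simps)
qed

lemma meval_0 [simp]: "meval \<zeta> 0 = 0"
  by (simp add: meval_def msubst_def)

lemma meval_single: "meval \<zeta> (Poly_Mapping.single m c) = c * (\<Prod>i \<in> Poly_Mapping.keys m. \<zeta> i ^ Poly_Mapping.lookup m i)"
  by (subst meval_superset[of "{m}"]) auto

lemma meval_mconst [simp]: "meval \<zeta> (mconst c) = c"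
  by (simp add: mconst_def meval_single)

lemma meval_mvar [simp]: "meval \<zeta> (mvar i) = \<zeta> i"
  by (simp add: mvar_def meval_single)

lemma meval_1 [simp]: "meval \<zeta> 1 = 1"
  using meval_mconst[of \<zeta> 1] by (simp add: mconst_def)

lemma meval_sum: "meval \<zeta> (\<Sum>i\<in>A. F i) = (\<Sum>i\<in>A. meval \<zeta> (F i))"
  by (induction A rule: infinite_finite_induct) (auto simp: meval_add)

lemma poly_mapping_eq_sum_single:
  "f = (\<Sum>m\<in>Poly_Mapping.keys f. Poly_Mapping.single m (Poly_Mapping.lookup f m))"
  by (rule poly_mapping_eqI)
     (simp add: lookup_sum lookup_single when_def in_keys_iff)

lemma meval_mult_single:
  "meval \<zeta> (Poly_Mapping.single m c * Poly_Mapping.single m' d)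
     = meval \<zeta> (Poly_Mapping.single m c) * meval \<zeta> (Poly_Mapping.single m' d)"
proof -
  let ?A = "Poly_Mapping.keys m \<union> Poly_Mapping.keys m'"
  have sup: "(\<Prod>i \<in> Poly_Mapping.keys k. \<zeta> i ^ Poly_Mapping.lookup k i) = (\<Prod>i\<in>?A. \<zeta> i ^ Poly_Mapping.lookup k i)"
    if "k \<in> {m, m', m + m'}" for k
    using that keys_add[of m m'] by (intro prod_keys_power_superset) auto
  show ?thesis
    unfolding mult_single meval_single
    by (simp only: sup insertI1 insertI2) (simp add: lookup_add power_add prod.distrib)
qed

lemma meval_mult: "meval \<zeta> (f * g) = meval \<zeta> f * meval \<zeta> g"
proof -
  let ?s = "\<lambda>f m. Poly_Mapping.single m (Poly_Mapping.lookup f m)"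
  have "f * g = (\<Sum>m\<in>Poly_Mapping.keys f. ?s f m) * (\<Sum>m\<in>Poly_Mapping.keys g. ?s g m)"
    by (simp only: poly_mapping_eq_sum_single[symmetric])
  then have "meval \<zeta> (f * g) = (\<Sum>m\<in>Poly_Mapping.keys f. meval \<zeta> (?s f m)) * (\<Sum>m\<in>Poly_Mapping.keys g. meval \<zeta> (?s g m))"
    by (simp only: sum_product meval_sum meval_mult_single)
  then show ?thesis
    by (simp only: meval_sum[symmetric] poly_mapping_eq_sum_single[symmetric])
qed

lemma meval_power: "meval \<zeta> (f ^ k) = meval \<zeta> f ^ k"
  by (induction k) (auto simp: meval_mult)

lemma meval_prod: "meval \<zeta> (\<Prod>i\<in>A. F i) = (\<Prod>i\<in>A. meval \<zeta> (F i))"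
  by (induction A rule: infinite_finite_induct) (auto simp: meval_mult)

text \<open>Evaluation is a ring homomorphism, so a substitution of variables can be moved to the
  point.\<close>

lemma meval_perm_act: "meval \<zeta> (perm_act \<sigma> f) = meval (\<zeta> \<circ> \<sigma>) f"
  by (simp add: perm_act_def msubst_def[of mconst] meval_sum meval_mult meval_prod meval_power)
     (simp add: meval_def msubst_def)

lemma meval_symmetrizer:
  "meval \<zeta> (symmetrizer G f) = 1 / of_nat (card G) * (\<Sum>\<sigma>\<in>G. meval (\<zeta> \<circ> \<sigma>) f)"
  by (simp add: symmetrizer_def meval_mult meval_sum meval_perm_act)

text \<open>All exponents that occur are 1, so each monomial is determined by its set of variables.
  From here on multiaffine polynomials are sums over sets.\<close>

lemma meval_multiaffine:
  assumes "multiaffine f"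
  shows "meval \<zeta> f = (\<Sum>m\<in>Poly_Mapping.keys f. Poly_Mapping.lookup f m * prod \<zeta> (Poly_Mapping.keys m))"
  unfolding meval_def msubst_def
proof (intro sum.cong refl arg_cong2[of _ _ _ _ "(*)"] prod.cong)
  fix m i assume "m \<in> Poly_Mapping.keys f" "i \<in> Poly_Mapping.keys m"
  then have "Poly_Mapping.lookup m i \<le> 1" "Poly_Mapping.lookup m i \<noteq> 0"
    using assms by (auto simp: multiaffine_def in_keys_iff)
  then have "Poly_Mapping.lookup m i = 1" by linarith
  then show "\<zeta> i ^ Poly_Mapping.lookup m i = \<zeta> i" by simp
qed

section \<open>Orbit homogeneous groups preserve stability\<close>

locale permutation_group =
  fixes n :: nat and G :: "(nat \<Rightarrow> nat) set"
  assumes subgroup_G: "subgroup G (sym_group n)"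
begin

abbreviation orbs :: "nat set set" where
  "orbs \<equiv> orbits (sym_group n\<lparr>carrier := G\<rparr>) {1..n} (\<lambda>\<sigma>. \<sigma>)"

lemma permutes_elem: "\<sigma> \<in> G \<Longrightarrow> \<sigma> permutes {1..n}"
  using subgroup.mem_carrier[OF subgroup_G] by (simp add: sym_group_carrier)

lemma inj_on_elem: "\<sigma> \<in> G \<Longrightarrow> inj_on \<sigma> A"
  by (meson permutes_elem permutes_inj inj_on_subset subset_UNIV)

lemma finite_G: "finite G"
  by (rule finite_subset[OF _ finite_permutations[of "{1..n}"]]) (auto simp: permutes_elem)

lemma id_in: "id \<in> G"
  using subgroup.one_closed[OF subgroup_G] by (simp add: sym_group_one)

lemma comp_in: "\<sigma> \<in> G \<Longrightarrow> \<tau> \<in> G \<Longrightarrow> \<sigma> \<circ> \<tau> \<in> G"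
  using subgroup.m_closed[OF subgroup_G] by (simp add: sym_group_mult)

lemma inv_in:
  assumes "\<sigma> \<in> G"
  shows "inv' \<sigma> \<in> G"
proof -
  interpret group "sym_group n" by (rule sym_group_is_group)
  have c: "\<sigma> \<in> carrier (sym_group n)" using assms by (simp add: permutes_elem sym_group_carrier)
  have i: "inv\<^bsub>sym_group n\<^esub> \<sigma> \<in> G" using subgroup.m_inv_closed[OF subgroup_G] assms by simp
  have "(inv\<^bsub>sym_group n\<^esub> \<sigma>) \<circ> \<sigma> = id"
    using l_inv[OF c] by (simp add: sym_group_mult sym_group_one)
  then have "inv\<^bsub>sym_group n\<^esub> \<sigma> = inv' \<sigma>"
    using permutes_inv_o(1)[OF permutes_elem[OF assms]] by (metis comp_assoc comp_id id_comp)
  then show ?thesis using i by simp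
qed

lemma card_pos: "card G > 0"
  using id_in finite_G by (auto simp: card_gt_0_iff)

lemma bij_left_mult: "\<rho> \<in> G \<Longrightarrow> bij_betw (\<lambda>\<sigma>. \<rho> \<circ> \<sigma>) G G"
proof (rule bij_betw_byWitness[where f' = "\<lambda>\<sigma>. inv' \<rho> \<circ> \<sigma>"])
  assume \<rho>: "\<rho> \<in> G"
  note p = permutes_inv_o[OF permutes_elem[OF \<rho>]]
  show "\<forall>\<sigma>\<in>G. inv' \<rho> \<circ> (\<rho> \<circ> \<sigma>) = \<sigma>" "\<forall>\<sigma>\<in>G. \<rho> \<circ> (inv' \<rho> \<circ> \<sigma>) = \<sigma>"
    using p by (simp_all add: o_assoc)
qed (auto intro: comp_in inv_in)

lemma orbit_eq: "orbit (sym_group n\<lparr>carrier := G\<rparr>) (\<lambda>\<sigma>. \<sigma>) x = (\<lambda>\<sigma>. \<sigma> x) ` G"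
  by (auto simp: orbit_def)

lemma orbs_eq: "orbs = (\<lambda>x. (\<lambda>\<sigma>. \<sigma> x) ` G) ` {1..n}"
  by (auto simp: orbits_def orbit_eq)

lemma finite_orbs: "finite orbs" "S \<in> orbs \<Longrightarrow> finite S"
  by (auto simp: orbs_eq finite_G)

lemma orb_subset: "S \<in> orbs \<Longrightarrow> S \<subseteq> {1..n}"
  using permutes_in_image[OF permutes_elem] by (auto simp: orbs_eq)

lemma orb_self: "x \<in> (\<lambda>\<sigma>. \<sigma> x) ` G"
  using id_in by (metis id_apply image_eqI)

lemma orb_trans:
  assumes "y \<in> (\<lambda>\<sigma>. \<sigma> x) ` G"
  shows "(\<lambda>\<sigma>. \<sigma> y) ` G = (\<lambda>\<sigma>. \<sigma> x) ` G"
proof -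
  obtain \<rho> where \<rho>: "\<rho> \<in> G" "y = \<rho> x" using assms by auto
  have "\<sigma> y \<in> (\<lambda>\<sigma>. \<sigma> x) ` G" if "\<sigma> \<in> G" for \<sigma>
    using comp_in[OF that \<rho>(1)] \<rho>(2) by (metis comp_apply image_eqI)
  moreover have "\<sigma> x \<in> (\<lambda>\<sigma>. \<sigma> y) ` G" if "\<sigma> \<in> G" for \<sigma>
  proof -
    have "(\<sigma> \<circ> inv' \<rho>) y = \<sigma> x"
      using \<rho> permutes_inverses(2)[OF permutes_elem[OF \<rho>(1)]] by simp
    then show ?thesis using comp_in[OF that inv_in[OF \<rho>(1)]] by (metis image_eqI)
  qed
  ultimately show ?thesis by auto
qed

lemma orbs_disjoint:
  assumes "S \<in> orbs" "T \<in> orbs" "x \<in> S" "x \<in> T"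
  shows "S = T"
proof -
  obtain y z where "S = (\<lambda>\<sigma>. \<sigma> y) ` G" "T = (\<lambda>\<sigma>. \<sigma> z) ` G"
    using assms(1,2) by (auto simp: orbs_eq)
  with assms(3,4) orb_trans[of x y] orb_trans[of x z] show ?thesis by simp
qed

lemma orb_closed:
  assumes "S \<in> orbs" "x \<in> S" "\<sigma> \<in> G"
  shows "\<sigma> x \<in> S"
proof -
  obtain y where "S = (\<lambda>\<sigma>. \<sigma> y) ` G" using assms(1) by (auto simp: orbs_eq)
  with assms orb_trans[of x y] show ?thesis by auto
qed

lemma orb_exists: "x \<in> {1..n} \<Longrightarrow> \<exists>S\<in>orbs. x \<in> S"
  unfolding orbs_eq using orb_self by blast

section \<open>Symmetry of orbit sums under transpositions within an orbit\<close>

text \<open>The transposition preserves all orbit counts, so by orbit homogeneity it permutes the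
  images of \<open>A\<close> under \<open>G\<close>. Each image arises from equally many \<sigma> as
  its transposed set, and the sum can be reindexed.\<close>

lemma sum_images_transpose:
  fixes F :: "nat set \<Rightarrow> complex"
  assumes hom: "orbit_homogeneous n G" and S: "S \<in> orbs" "s \<in> S" "t \<in> S" and A: "A \<subseteq> {1..n}"
  shows "(\<Sum>\<sigma>\<in>G. F (transpose s t ` \<sigma> ` A)) = (\<Sum>\<sigma>\<in>G. F (\<sigma> ` A))"
proof -
  let ?\<tau> = "transpose s t"
  define N where "N = (\<lambda>B. of_nat (card {\<sigma> \<in> G. \<sigma> ` A = B}) :: complex)"
  define O' where "O' = (\<lambda>\<sigma>. \<sigma> ` A) ` G"
  have fin: "finite O'" using finite_G by (simp add: O'_def)
  \<comment> \<open>The transposition need not belong to \<open>G\<close>, but on each single set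
    some element of \<open>G\<close>, depending on the set, has the same effect.\<close>
  have move: "\<exists>\<rho>\<in>G. \<rho> ` B = ?\<tau> ` B" if "B \<in> O'" for B
  proof -
    have B: "B \<subseteq> {1..n}"
      using that A permutes_in_image[OF permutes_elem] by (auto simp: O'_def)
    have st: "s \<in> {1..n}" "t \<in> {1..n}" using S orb_subset[OF S(1)] by auto
    have "?\<tau> ` B \<subseteq> {1..n}" using B st by (auto simp: transpose_def)
    moreover have "card (B \<inter> T) = card (?\<tau> ` B \<inter> T)" if "T \<in> orbs" for T
    proof -
      have "?\<tau> ` T = T"
      proof (cases "T = S")
        case True
        then show ?thesis using S by simp
      next
        case False
        then have "s \<notin> T" "t \<notin> T" using orbs_disjoint S that by blast+
        then show ?thesis by simp
      qed
      then have "?\<tau> ` B \<inter> T = ?\<tau> ` (B \<inter> T)"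
        by (metis image_Int inj_transpose)
      moreover have "inj_on ?\<tau> (B \<inter> T)" by (rule inj_on_subset[OF inj_transpose]) simp
      ultimately show ?thesis using card_image by metis
    qed
    ultimately show ?thesis
      by (intro hom[unfolded orbit_homogeneous_def, rule_format] B)
  qed
  have closed: "?\<tau> ` B \<in> O'" if B: "B \<in> O'" for B
  proof -
    obtain \<rho> where \<rho>: "\<rho> \<in> G" "\<rho> ` B = ?\<tau> ` B" using move[OF B] by blast
    obtain \<sigma> where \<sigma>: "\<sigma> \<in> G" "B = \<sigma> ` A" using B by (auto simp: O'_def)
    have "?\<tau> ` B = (\<rho> \<circ> \<sigma>) ` A" using \<rho> \<sigma> by (simp add: image_comp)
    then show ?thesis unfolding O'_def using comp_in[OF \<rho>(1) \<sigma>(1)] by (rule image_eqI)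
  qed
  have N: "N (?\<tau> ` B) = N B" if B: "B \<in> O'" for B
  proof -
    obtain \<rho> where \<rho>: "\<rho> \<in> G" "\<rho> ` B = ?\<tau> ` B" using move[OF B] by blast
    have "bij_betw (\<lambda>\<sigma>. \<rho> \<circ> \<sigma>) {\<sigma> \<in> G. \<sigma> ` A = B} {\<sigma> \<in> G. \<sigma> ` A = \<rho> ` B}"
    proof (rule bij_betw_subset[OF bij_left_mult[OF \<rho>(1)]])
      show "(\<lambda>\<sigma>. \<rho> \<circ> \<sigma>) ` {\<sigma> \<in> G. \<sigma> ` A = B} = {\<sigma> \<in> G. \<sigma> ` A = \<rho> ` B}"
      proof (intro equalityI subsetI)
        fix \<sigma> assume "\<sigma> \<in> {\<sigma> \<in> G. \<sigma> ` A = \<rho> ` B}"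
        then have \<sigma>: "\<sigma> \<in> G" "\<sigma> ` A = \<rho> ` B" by auto
        have "(inv' \<rho> \<circ> \<sigma>) ` A = B"
          unfolding image_comp[symmetric] \<sigma>(2) by (rule image_inv_f_f[OF permutes_inj[OF permutes_elem[OF \<rho>(1)]]])
        moreover have "\<rho> \<circ> (inv' \<rho> \<circ> \<sigma>) = \<sigma>"
          using permutes_inv_o(1)[OF permutes_elem[OF \<rho>(1)]] by (simp add: o_assoc)
        ultimately show "\<sigma> \<in> (\<lambda>\<sigma>. \<rho> \<circ> \<sigma>) ` {\<sigma> \<in> G. \<sigma> ` A = B}"
          using comp_in[OF inv_in[OF \<rho>(1)] \<sigma>(1)] by (metis (mono_tags, lifting) image_eqI mem_Collect_eq)
      next
        fix \<pi> assume "\<pi> \<in> (\<lambda>\<sigma>. \<rho> \<circ> \<sigma>) ` {\<sigma> \<in> G. \<sigma> ` A = B}"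
        then obtain \<sigma> where \<sigma>: "\<pi> = \<rho> \<circ> \<sigma>" "\<sigma> \<in> G" "\<sigma> ` A = B" by auto
        have "\<pi> ` A = \<rho> ` B" unfolding \<sigma>(1) image_comp[symmetric] \<sigma>(3) ..
        then show "\<pi> \<in> {\<sigma> \<in> G. \<sigma> ` A = \<rho> ` B}" using comp_in[OF \<rho>(1) \<sigma>(2)] \<sigma>(1) by simp
      qed
    qed auto
    then show ?thesis unfolding N_def \<rho>(2)[symmetric] by (simp only: bij_betw_same_card)
  qed
  have expand: "(\<Sum>\<sigma>\<in>G. F' (\<sigma> ` A)) = (\<Sum>B\<in>O'. N B * F' B)" for F' :: "nat set \<Rightarrow> complex"
  proof -
    have "(\<Sum>\<sigma>\<in>G. F' (\<sigma> ` A)) = (\<Sum>B\<in>O'. \<Sum>\<sigma>\<in>{\<sigma> \<in> G. \<sigma> ` A = B}. F' (\<sigma> ` A))"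
      unfolding O'_def using finite_G by (rule sum.image_gen)
    also have "\<dots> = (\<Sum>B\<in>O'. N B * F' B)"
      by (intro sum.cong refl) (simp add: N_def)
    finally show ?thesis .
  qed
  have inj: "inj_on ((`) ?\<tau>) O'"
    by (rule inj_on_subset[OF inj_on_image[of _ UNIV]]) auto
  have im: "((`) ?\<tau>) ` O' = O'"
    using closed fin inj by (intro endo_inj_surj) auto
  have "(\<Sum>\<sigma>\<in>G. F (?\<tau> ` \<sigma> ` A)) = (\<Sum>B\<in>O'. N (?\<tau> ` B) * F (?\<tau> ` B))"
    unfolding expand[of "\<lambda>B. F (?\<tau> ` B)"] by (intro sum.cong refl) (simp only: N)
  also have "\<dots> = (\<Sum>B\<in>O'. N B * F B)"
    using sum.reindex[OF inj, of "\<lambda>B. N B * F B"] by (simp add: im)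
  finally show ?thesis by (simp add: expand)
qed

end

section \<open>Closure properties of separate affinity\<close>

lemma affine_in_sum:
  assumes "\<And>i. i \<in> I \<Longrightarrow> affine_in s (F i)"
  shows "affine_in s (\<lambda>\<zeta>. \<Sum>i\<in>I. F i \<zeta>)"
  unfolding affine_in_def
proof (intro allI)
  fix \<zeta> w
  have "(\<Sum>i\<in>I. F i (\<zeta>(s := w))) = (\<Sum>i\<in>I. (1 - w) * F i (\<zeta>(s := 0)) + w * F i (\<zeta>(s := 1)))"
    by (intro sum.cong refl affine_inD assms)
  then show "(\<Sum>i\<in>I. F i (\<zeta>(s := w))) = (1 - w) * (\<Sum>i\<in>I. F i (\<zeta>(s := 0))) + w * (\<Sum>i\<in>I. F i (\<zeta>(s := 1)))"
    by (simp only: sum.distrib sum_distrib_left)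
qed

lemma affine_in_cmult:
  assumes "affine_in s F"
  shows "affine_in s (\<lambda>\<zeta>. c * F \<zeta>)"
  unfolding affine_in_def
proof (intro allI)
  fix \<zeta> w
  show "c * F (\<zeta>(s := w)) = (1 - w) * (c * F (\<zeta>(s := 0))) + w * (c * F (\<zeta>(s := 1)))"
    unfolding affine_inD[OF assms, of \<zeta> w] by (simp add: algebra_simps)
qed

lemma affine_in_prod:
  assumes "finite A"
  shows "affine_in s (\<lambda>\<zeta>. prod \<zeta> A)"
proof -
  have "prod (\<zeta>(s := w)) A = (if s \<in> A then w * prod \<zeta> (A - {s}) else prod \<zeta> A)" for \<zeta> :: "'a \<Rightarrow> complex" and w
  proof (cases "s \<in> A")
    case True
    have "prod (\<zeta>(s := w)) (A - {s}) = prod \<zeta> (A - {s})" by (rule prod.cong) auto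
    with True show ?thesis using prod.remove[OF assms True, of "\<zeta>(s := w)"] by simp
  next
    case False
    then have "prod (\<zeta>(s := w)) A = prod \<zeta> A" by (intro prod.cong) auto
    with False show ?thesis by simp
  qed
  then show ?thesis unfolding affine_in_def by (simp add: algebra_simps)
qed

section \<open>The symmetrizer of a multiaffine polynomial\<close>

context permutation_group
begin

text \<open>A permutation sends the monomial of a set to the monomial of the image set, so every
  monomial of \<open>f\<close> contributes a sum over the images of its set of variables.\<close>

lemma meval_symmetrizer_multiaffine:
  assumes "multiaffine f"
  shows "meval \<zeta> (symmetrizer G f) = 1 / of_nat (card G) *
    (\<Sum>m\<in>Poly_Mapping.keys f. Poly_Mapping.lookup f m * (\<Sum>\<sigma>\<in>G. prod \<zeta> (\<sigma> ` Poly_Mapping.keys m)))"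
proof -
  have "(\<Sum>\<sigma>\<in>G. meval (\<zeta> \<circ> \<sigma>) f) =
    (\<Sum>\<sigma>\<in>G. \<Sum>m\<in>Poly_Mapping.keys f. Poly_Mapping.lookup f m * prod \<zeta> (\<sigma> ` Poly_Mapping.keys m))"
    unfolding meval_multiaffine[OF assms] by (intro sum.cong refl) (simp add: prod.reindex inj_on_elem)
  also have "\<dots> = (\<Sum>m\<in>Poly_Mapping.keys f. Poly_Mapping.lookup f m * (\<Sum>\<sigma>\<in>G. prod \<zeta> (\<sigma> ` Poly_Mapping.keys m)))"
    by (subst sum.swap) (simp only: sum_distrib_left)
  finally show ?thesis by (simp only: meval_symmetrizer)
qed

text \<open>Supplies the symmetry hypothesis of the Grace--Walsh--Szego theorem: the transposition
  is moved from the point to the sets, where \<open>sum_images_transpose\<close> absorbs it.\<close>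

lemma meval_symmetrizer_transpose:
  assumes "orbit_homogeneous n G" "f \<in> mpolys n" "multiaffine f" "S \<in> orbs" "s \<in> S" "t \<in> S"
  shows "meval (\<zeta> \<circ> transpose s t) (symmetrizer G f) = meval \<zeta> (symmetrizer G f)"
proof -
  have key: "(\<Sum>\<sigma>\<in>G. prod (\<zeta> \<circ> transpose s t) (\<sigma> ` Poly_Mapping.keys m)) = (\<Sum>\<sigma>\<in>G. prod \<zeta> (\<sigma> ` Poly_Mapping.keys m))"
    if "m \<in> Poly_Mapping.keys f" for m
  proof -
    have "Poly_Mapping.keys m \<subseteq> {1..n}" using assms(2) that by (auto simp: mpolys_def)
    note sum_images_transpose[OF assms(1,4,5,6) this, of "prod \<zeta>"]
    moreover have "prod (\<zeta> \<circ> transpose s t) X = prod \<zeta> (transpose s t ` X)" for X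
      by (rule prod.reindex[symmetric]) (rule inj_on_subset[OF inj_transpose], simp)
    ultimately show ?thesis by (simp only:)
  qed
  show ?thesis
    unfolding meval_symmetrizer_multiaffine[OF assms(3)] by (simp only: key cong: sum.cong)
qed

lemma affine_in_symmetrizer:
  assumes "multiaffine f"
  shows "affine_in s (\<lambda>\<zeta>. meval \<zeta> (symmetrizer G f))"
  unfolding meval_symmetrizer_multiaffine[OF assms]
  by (intro affine_in_cmult affine_in_sum affine_in_prod finite_imageI finite_keys)

text \<open>Elements of \<open>G\<close> preserve each orbit, so they do not change the coordinates
  that \<open>f\<close> sees, and the average is over equal terms.\<close>

lemma meval_symmetrizer_orbit_constant:
  assumes "f \<in> mpolys n" "\<And>S i j. S \<in> orbs \<Longrightarrow> i \<in> S \<Longrightarrow> j \<in> S \<Longrightarrow> \<zeta> i = \<zeta> j"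
  shows "meval \<zeta> (symmetrizer G f) = meval \<zeta> f"
proof -
  have eq: "\<zeta> (\<sigma> i) = \<zeta> i" if "\<sigma> \<in> G" "i \<in> {1..n}" for \<sigma> i
    using assms(2) orb_exists[OF that(2)] orb_closed that(1) by metis
  have "meval (\<zeta> \<circ> \<sigma>) f = meval \<zeta> f" if "\<sigma> \<in> G" for \<sigma>
    unfolding meval_def msubst_def
  proof (intro sum.cong refl arg_cong2[of _ _ _ _ "(*)"] prod.cong)
    fix m i assume "m \<in> Poly_Mapping.keys f" "i \<in> Poly_Mapping.keys m"
    then have "i \<in> {1..n}" using assms(1) unfolding mpolys_def by blast
    then show "(\<zeta> \<circ> \<sigma>) i ^ Poly_Mapping.lookup m i = \<zeta> i ^ Poly_Mapping.lookup m i"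
      using eq[OF that] by simp
  qed
  then show ?thesis using card_pos by (simp add: meval_symmetrizer)
qed

lemma stable_symmetrizer:
  assumes hom: "orbit_homogeneous n G" and f: "f \<in> mpolys n" "multiaffine f" "stable_poly n f"
  shows "stable_poly n (symmetrizer G f)"
proof -
  let ?h = "\<lambda>\<zeta>. meval \<zeta> (symmetrizer G f)"
  \<comment> \<open>\<open>F\<close> is the set of orbits on which the point may be nonconstant. For
    empty \<open>F\<close> the symmetrizer agrees with \<open>f\<close>; each further orbit is
    released by the Grace--Walsh--Szego theorem, and \<open>F = orbs\<close> is the full
    claim.\<close>
  have claim: "?h \<zeta> \<noteq> 0"
    if "finite F" "F \<subseteq> orbs" "\<forall>i\<in>{1..n}. Im (\<zeta> i) > 0"
      "\<forall>S\<in>orbs - F. \<forall>i\<in>S. \<forall>j\<in>S. \<zeta> i = \<zeta> j" for F \<zeta>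
    using that
  proof (induction F arbitrary: \<zeta> rule: finite_induct)
    case empty
    then have "?h \<zeta> = meval \<zeta> f" by (intro meval_symmetrizer_orbit_constant f) blast
    then show ?case using f(3) empty(2) by (simp add: stable_poly_def)
  next
    case (insert S F)
    have S: "S \<in> orbs" using insert.prems(1) by simp
    show ?case
    proof (rule Grace_Walsh_Szego_upper_half_plane[of S ?h])
      fix \<xi> :: complex assume \<xi>: "Im \<xi> > 0"
      show "?h (override_on \<zeta> (\<lambda>_. \<xi>) S) \<noteq> 0"
      proof (rule insert.IH)
        show "F \<subseteq> orbs" using insert.prems(1) by simp
        show "\<forall>i\<in>{1..n}. 0 < Im (override_on \<zeta> (\<lambda>_. \<xi>) S i)"
          using insert.prems(2) \<xi> by (simp add: override_on_def)
        show "\<forall>T\<in>orbs - F. \<forall>i\<in>T. \<forall>j\<in>T. override_on \<zeta> (\<lambda>_. \<xi>) S i = override_on \<zeta> (\<lambda>_. \<xi>) S j"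
        proof (intro ballI)
          fix T i j assume T: "T \<in> orbs - F" "i \<in> T" "j \<in> T"
          show "override_on \<zeta> (\<lambda>_. \<xi>) S i = override_on \<zeta> (\<lambda>_. \<xi>) S j"
          proof (cases "T = S")
            case True
            then show ?thesis using T by simp
          next
            case False
            then have "i \<notin> S" "j \<notin> S" using orbs_disjoint S T by blast+
            moreover have "\<zeta> i = \<zeta> j" using insert.prems(3) T False by blast
            ultimately show ?thesis by simp
          qed
        qed
      qed
    next
      show "Im (\<zeta> s) > 0" if "s \<in> S" for s using insert.prems(2) orb_subset[OF S] that by blast
    qed (use finite_orbs(2)[OF S] affine_in_symmetrizer[OF f(2)] meval_symmetrizer_transpose[OF hom f(1,2) S] in blast)+
  qed
  show ?thesis
    unfolding stable_poly_def by (intro allI impI claim[OF finite_orbs(1) subset_refl]) auto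
qed

end

section \<open>Groups preserving stability are orbit homogeneous\<close>

lemma sum_if_const:
  "finite I \<Longrightarrow> (\<Sum>i\<in>I. if P i then c else 0) = of_nat (card {i \<in> I. P i}) * (c :: complex)"
  by (simp add: sum.inter_filter[symmetric])

text \<open>Write \<open>x\<^sub>i\<close> for the variables. Sending those of \<open>U\<close> to infinity and those outside
  \<open>U \<union> {a, b, c, z}\<close> to \<open>0\<close> leaves, if \<open>x\<^sub>a x\<^sub>b\<close> and \<open>x\<^sub>b x\<^sub>c\<close> are both missing, the
  quadratic form \<open>k\<^sub>1 x\<^sub>b x\<^sub>z + k\<^sub>2 x\<^sub>a x\<^sub>c + k x\<^sub>z x\<^sub>c + l x\<^sub>z x\<^sub>a\<close> with \<open>k\<^sub>1, k\<^sub>2 > 0\<close>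
  and \<open>k, l \<ge> 0\<close>. It vanishes in the upper half-plane for \<open>x\<^sub>z = \<i>\<close> and
  \<open>x\<^sub>a = x\<^sub>c = t + \<i>\<close> with \<open>t\<close> large, and so does the original polynomial nearby.\<close>

lemma stable_exchange:
  fixes B :: "'g \<Rightarrow> 'v set"
  assumes fin: "finite I" "finite V" and BV: "\<And>\<sigma>. \<sigma> \<in> I \<Longrightarrow> B \<sigma> \<subseteq> V"
    and cardB: "\<And>\<sigma>. \<sigma> \<in> I \<Longrightarrow> card (B \<sigma>) = card U + 2"
    and nz: "\<And>\<zeta>. (\<And>i. i \<in> V \<Longrightarrow> Im (\<zeta> i) > 0) \<Longrightarrow> (\<Sum>\<sigma>\<in>I. prod \<zeta> (B \<sigma>)) \<noteq> 0"
    and UV: "U \<subseteq> V" and WV: "{a, b, c, z} \<subseteq> V" and UW: "U \<inter> {a, b, c, z} = {}"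
    and dist: "distinct [a, b, c, z]"
    and bz: "insert b (insert z U) \<in> B ` I" and ac: "insert a (insert c U) \<in> B ` I"
    and bc: "insert b (insert c U) \<notin> B ` I"
  shows "insert a (insert b U) \<in> B ` I"
proof (rule ccontr)
  assume ab: "insert a (insert b U) \<notin> B ` I"
  define W where "W = {a, b, c, z}"
  \<comment> \<open>Large enough for \<open>x\<^sup>2 - 1\<close> to exceed \<open>card I\<close>,
    and hence the coefficient \<open>n3\<close> below; this makes the imaginary part of
    \<open>r0\<close> positive.\<close>
  define x where "x = real (card I) + 2"
  define v where "v = Complex x 1"
  \<comment> \<open>The test point on \<open>W\<close>. The value \<open>w\<close> at
    \<open>b\<close> stays free and is solved for at the end.\<close>
  define \<omega> where "\<omega> = (\<lambda>w i. if i = b then w else if i = z then \<i> else v)"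
  define pt where "pt = (\<lambda>(\<epsilon>::real) w i. if i \<in> U then \<i> / \<epsilon> else if i \<in> W then \<omega> w i else \<i> * \<epsilon>)"
  \<comment> \<open>The prefactor cancels the growth of the coordinates in \<open>U\<close>, so that
    a limit exists as \<epsilon> tends to 0.\<close>
  define H where "H = (\<lambda>(\<epsilon>::real) w. (\<epsilon> / \<i>) ^ card U * (\<Sum>\<sigma>\<in>I. prod (pt \<epsilon> w) (B \<sigma>)))"
  \<comment> \<open>These terms survive in the limit. In any other term, an element of
    \<open>U\<close> missing from \<open>B \<sigma>\<close> leaves a factor
    \<open>\<epsilon> / \<i>\<close>, or an element outside \<open>U \<union> W\<close> contributes
    a factor \<open>\<i> * \<epsilon>\<close>.\<close>
  define good where "good = (\<lambda>\<sigma>. U \<subseteq> B \<sigma> \<and> B \<sigma> \<subseteq> U \<union> W)"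
  define l where "l = (\<lambda>\<sigma> w. if good \<sigma> then prod (\<omega> w) (B \<sigma> \<inter> W) else 0)"
  have finU: "finite U" using UV fin(2) finite_subset by blast

  have term_lim: "((\<lambda>\<epsilon>::real. (\<epsilon> / \<i>) ^ card U * prod (pt \<epsilon> w) (B \<sigma>)) \<longlongrightarrow> l \<sigma> w) (at_right 0)"
    if \<sigma>: "\<sigma> \<in> I" for \<sigma> w
  proof -
    \<comment> \<open>The prefactor is distributed over \<open>U\<close>, one factor per element.
      The term becomes a product over \<open>V\<close> in which each factor converges, with limit
      \<open>L\<close>.\<close>
    define g where "g = (\<lambda>(\<epsilon>::real) i. if i \<in> U then (if i \<in> B \<sigma> then 1 else \<epsilon> / \<i>)
      else if i \<in> B \<sigma> then (if i \<in> W then \<omega> w i else \<i> * \<epsilon>) else 1)"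
    define L where "L = (\<lambda>i. if i \<in> U then (if i \<in> B \<sigma> then 1 else 0)
      else if i \<in> B \<sigma> then (if i \<in> W then \<omega> w i else 0) else 1)"
    have eq: "(\<epsilon> / \<i>) ^ card U * prod (pt \<epsilon> w) (B \<sigma>) = (\<Prod>i\<in>V. g \<epsilon> i)" if "\<epsilon> > 0" for \<epsilon> :: real
    proof -
      have "(\<epsilon> / \<i>) ^ card U = (\<Prod>i\<in>V. if i \<in> U then \<epsilon> / \<i> else 1)"
        using UV fin(2) by (simp add: prod.If_cases Int_absorb1)
      moreover have "prod (pt \<epsilon> w) (B \<sigma>) = (\<Prod>i\<in>V. if i \<in> B \<sigma> then pt \<epsilon> w i else 1)"
        using BV[OF \<sigma>] fin(2) by (simp add: prod.If_cases Int_absorb1)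
      ultimately have "(\<epsilon> / \<i>) ^ card U * prod (pt \<epsilon> w) (B \<sigma>)
          = (\<Prod>i\<in>V. (if i \<in> U then \<epsilon> / \<i> else 1) * (if i \<in> B \<sigma> then pt \<epsilon> w i else 1))"
        by (simp only: prod.distrib)
      also have "\<dots> = (\<Prod>i\<in>V. g \<epsilon> i)"
        using that by (intro prod.cong refl) (simp add: g_def pt_def)
      finally show ?thesis .
    qed
    have "((\<lambda>\<epsilon>. \<Prod>i\<in>V. g \<epsilon> i) \<longlongrightarrow> (\<Prod>i\<in>V. L i)) (at_right 0)"
    proof (rule tendsto_prod)
      fix i
      have "((\<lambda>\<epsilon>::real. \<epsilon> / \<i>) \<longlongrightarrow> 0) (at_right 0)" "((\<lambda>\<epsilon>::real. \<i> * \<epsilon>) \<longlongrightarrow> 0) (at_right 0)"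
        by (auto intro!: tendsto_eq_intros)
      then show "((\<lambda>\<epsilon>. g \<epsilon> i) \<longlongrightarrow> L i) (at_right 0)"
        by (simp add: g_def L_def)
    qed
    moreover have "(\<Prod>i\<in>V. L i) = l \<sigma> w"
    proof (cases "good \<sigma>")
      case True
      have "(\<Prod>i\<in>V. L i) = (\<Prod>i\<in>V. if i \<in> B \<sigma> \<inter> W then \<omega> w i else 1)"
        using True UW by (intro prod.cong refl) (auto simp: L_def good_def W_def)
      also have "\<dots> = prod (\<omega> w) (V \<inter> (B \<sigma> \<inter> W))"
        using fin(2) by (rule prod.inter_restrict[symmetric])
      also have "V \<inter> (B \<sigma> \<inter> W) = B \<sigma> \<inter> W" using BV[OF \<sigma>] by auto
      finally show ?thesis using True by (simp add: l_def)
    next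
      case False
      then consider i where "i \<in> U" "i \<notin> B \<sigma>" | i where "i \<in> B \<sigma>" "i \<notin> U" "i \<notin> W"
        by (auto simp: good_def)
      then obtain i where "i \<in> V" "L i = 0"
      proof cases
        case 1
        then show thesis using UV by (intro that[of i]) (auto simp: L_def)
      next
        case 2
        then show thesis using BV[OF \<sigma>] by (intro that[of i]) (auto simp: L_def)
      qed
      then have "(\<Prod>i\<in>V. L i) = 0" using fin(2) by (intro prod_zero) auto
      then show ?thesis using False by (simp add: l_def)
    qed
    ultimately have "((\<lambda>\<epsilon>. \<Prod>i\<in>V. g \<epsilon> i) \<longlongrightarrow> l \<sigma> w) (at_right 0)" by simp
    moreover have "\<forall>\<^sub>F \<epsilon> in at_right 0. (\<Prod>i\<in>V. g \<epsilon> i) = (\<epsilon> / \<i>) ^ card U * prod (pt \<epsilon> w) (B \<sigma>)"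
      using eventually_at_right_less by eventually_elim (simp only: eq)
    ultimately show ?thesis by (rule Lim_transform_eventually)
  qed
  have H_lim: "((\<lambda>\<epsilon>. H \<epsilon> w) \<longlongrightarrow> (\<Sum>\<sigma>\<in>I. l \<sigma> w)) (at_right 0)" for w
    unfolding H_def sum_distrib_left by (intro tendsto_sum term_lim)

  define n1 where "n1 = card {\<sigma> \<in> I. good \<sigma> \<and> B \<sigma> \<inter> W = {b, z}}"
  define n2 where "n2 = card {\<sigma> \<in> I. good \<sigma> \<and> B \<sigma> \<inter> W = {a, c}}"
  define n3 where "n3 = card {\<sigma> \<in> I. good \<sigma> \<and> (B \<sigma> \<inter> W = {z, c} \<or> B \<sigma> \<inter> W = {z, a})}"
  \<comment> \<open>By cardinality a surviving \<open>B \<sigma>\<close> meets \<open>W\<close> in a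
    pair. Of the six pairs, \<open>{a, b}\<close> and \<open>{b, c}\<close> are excluded;
    \<open>{z, c}\<close> and \<open>{z, a}\<close> give the same value since \<open>a\<close> and
    \<open>c\<close> carry the same coordinate.\<close>
  have l_eq: "l \<sigma> w = (if good \<sigma> \<and> B \<sigma> \<inter> W = {b, z} then \<i> * w else 0)
      + (if good \<sigma> \<and> B \<sigma> \<inter> W = {a, c} then v\<^sup>2 else 0)
      + (if good \<sigma> \<and> (B \<sigma> \<inter> W = {z, c} \<or> B \<sigma> \<inter> W = {z, a}) then \<i> * v else 0)" if \<sigma>: "\<sigma> \<in> I" for \<sigma> w
  proof (cases "good \<sigma>")
    case True
    then have B: "B \<sigma> = U \<union> (B \<sigma> \<inter> W)" by (auto simp: good_def)
    have "card (U \<union> (B \<sigma> \<inter> W)) = card U + card (B \<sigma> \<inter> W)"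
      using finU UW by (intro card_Un_disjoint) (auto simp: W_def)
    then have "card (B \<sigma> \<inter> W) = 2" using cardB[OF \<sigma>] unfolding B[symmetric] by simp
    then obtain p q where pq: "B \<sigma> \<inter> W = {p, q}" "p \<noteq> q" by (auto simp: card_2_iff)
    then have "p \<in> W" "q \<in> W" by auto
    moreover have "{p, q} \<noteq> {a, b}"
    proof
      assume "{p, q} = {a, b}"
      then have "B \<sigma> = insert a (insert b U)" using B unfolding pq(1) by auto
      then show False using ab \<sigma> by blast
    qed
    moreover have "{p, q} \<noteq> {b, c}"
    proof
      assume "{p, q} = {b, c}"
      then have "B \<sigma> = insert b (insert c U)" using B unfolding pq(1) by auto
      then show False using bc \<sigma> by blast
    qed
    ultimately show ?thesis
      using True dist pq(2) unfolding l_def pq(1)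
      by (auto simp: W_def \<omega>_def doubleton_eq_iff power2_eq_square)
  qed (simp add: l_def)
  have Q: "(\<Sum>\<sigma>\<in>I. l \<sigma> w) = of_nat n1 * (\<i> * w) + of_nat n2 * v\<^sup>2 + of_nat n3 * (\<i> * v)" for w
    using fin(1) by (simp add: l_eq sum.distrib sum_if_const n1_def n2_def n3_def cong: sum.cong)
  have n1: "n1 > 0"
  proof -
    obtain \<sigma> where "\<sigma> \<in> I" "B \<sigma> = insert b (insert z U)" using bz by auto
    then have "\<sigma> \<in> {\<sigma> \<in> I. good \<sigma> \<and> B \<sigma> \<inter> W = {b, z}}" using UW by (auto simp: good_def W_def)
    then show ?thesis unfolding n1_def using fin(1) by (auto simp: card_gt_0_iff)
  qed
  have n2: "n2 > 0"
  proof -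
    obtain \<sigma> where "\<sigma> \<in> I" "B \<sigma> = insert a (insert c U)" using ac by auto
    then have "\<sigma> \<in> {\<sigma> \<in> I. good \<sigma> \<and> B \<sigma> \<inter> W = {a, c}}" using UW by (auto simp: good_def W_def)
    then show ?thesis unfolding n2_def using fin(1) by (auto simp: card_gt_0_iff)
  qed
  have n3: "n3 \<le> card I" unfolding n3_def using fin(1) by (intro card_mono) auto

  \<comment> \<open>\<open>H \<epsilon>\<close> is affine in \<open>w\<close>, so its root has an
    explicit formula whose limit is the root \<open>r0\<close> of the limiting form. Convergence of
    roots is thus convergence of a quotient.\<close>
  define r where "r = (\<lambda>\<epsilon>. - H \<epsilon> 0 / (H \<epsilon> 1 - H \<epsilon> 0))"
  define r0 where "r0 = - (of_nat n2 * v\<^sup>2 + of_nat n3 * (\<i> * v)) / (of_nat n1 * \<i>)"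
  have "Im r0 = (real n2 * (x\<^sup>2 - 1) - real n3) / real n1"
    using n1 by (simp add: r0_def v_def Im_divide power2_eq_square field_simps)
  moreover have x: "real (card I) < x\<^sup>2 - 1"
    by (simp add: x_def power2_eq_square algebra_simps add_pos_nonneg)
  then have "x\<^sup>2 - 1 \<le> real n2 * (x\<^sup>2 - 1)"
    using n2 mult_right_mono[of 1 "real n2" "x\<^sup>2 - 1"] by simp
  then have "real n3 < real n2 * (x\<^sup>2 - 1)"
    using x of_nat_mono[OF n3, where 'a = real] by (meson le_less_trans less_le_trans)
  ultimately have "Im r0 > 0" using n1 by (simp only: zero_less_divide_iff) simp
  have den_lim: "((\<lambda>\<epsilon>. H \<epsilon> 1 - H \<epsilon> 0) \<longlongrightarrow> of_nat n1 * \<i>) (at_right 0)"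
    using tendsto_diff[OF H_lim[of 1] H_lim[of 0]] by (simp add: Q)
  have "of_nat n1 * \<i> \<noteq> 0" using n1 by simp
  then have "(r \<longlongrightarrow> r0) (at_right 0)"
    unfolding r_def r0_def using tendsto_divide[OF tendsto_minus[OF H_lim[of 0]] den_lim] by (simp add: Q)
  then have "((\<lambda>\<epsilon>. Im (r \<epsilon>)) \<longlongrightarrow> Im r0) (at_right 0)" by (rule tendsto_Im)
  then have "\<forall>\<^sub>F \<epsilon> in at_right 0. Im (r \<epsilon>) > 0" using \<open>Im r0 > 0\<close> by (rule order_tendstoD)
  moreover have "\<forall>\<^sub>F \<epsilon> in at_right 0. H \<epsilon> 1 - H \<epsilon> 0 \<noteq> 0"
    using den_lim \<open>of_nat n1 * \<i> \<noteq> 0\<close> by (rule tendsto_imp_eventually_ne)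
  ultimately have "\<forall>\<^sub>F \<epsilon> in at_right (0::real). Im (r \<epsilon>) > 0 \<and> H \<epsilon> 1 - H \<epsilon> 0 \<noteq> 0 \<and> \<epsilon> > 0"
    using eventually_at_right_less by eventually_elim simp
  then obtain \<epsilon> :: real where \<epsilon>: "Im (r \<epsilon>) > 0" "H \<epsilon> 1 - H \<epsilon> 0 \<noteq> 0" "\<epsilon> > 0"
    using eventually_happens'[OF trivial_limit_at_right_real] by blast
  have aff: "affine_in b (\<lambda>\<zeta>. (\<epsilon> / \<i>) ^ card U * (\<Sum>\<sigma>\<in>I. prod \<zeta> (B \<sigma>)))"
    using BV fin(2) by (intro affine_in_cmult affine_in_sum affine_in_prod) (blast intro: finite_subset)
  have pt: "pt \<epsilon> w = (pt \<epsilon> 0)(b := w)" for w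
    using UW by (auto simp: pt_def \<omega>_def W_def fun_eq_iff)
  have H: "H \<epsilon> w = (\<epsilon> / \<i>) ^ card U * (\<Sum>\<sigma>\<in>I. prod ((pt \<epsilon> 0)(b := w)) (B \<sigma>))" for w
    unfolding H_def pt[of w] ..
  have "H \<epsilon> w = (1 - w) * H \<epsilon> 0 + w * H \<epsilon> 1" for w
    unfolding H by (rule affine_inD[OF aff])
  from this[of "r \<epsilon>"] have "H \<epsilon> (r \<epsilon>) = H \<epsilon> 0 + r \<epsilon> * (H \<epsilon> 1 - H \<epsilon> 0)" by (simp add: algebra_simps)
  also have "\<dots> = 0" using \<epsilon>(2) by (simp add: r_def)
  finally have "(\<Sum>\<sigma>\<in>I. prod (pt \<epsilon> (r \<epsilon>)) (B \<sigma>)) = 0" using \<epsilon>(3) by (simp add: H_def)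
  moreover have "Im (pt \<epsilon> (r \<epsilon>) i) > 0" for i
    using \<epsilon> by (simp add: pt_def \<omega>_def v_def Im_divide power2_eq_square)
  ultimately show False using nz by blast
qed

section \<open>From basis exchange to orbit homogeneity\<close>

context permutation_group
begin

text \<open>The monomial of \<open>A\<close> is multiaffine, and stable because a product of nonzero
  numbers is nonzero. Its symmetrizer is this sum up to the factor
  \<open>1 / card G\<close>.\<close>

lemma sum_monomial_images_nonzero:
  assumes "\<forall>f \<in> mpolys n. multiaffine f \<and> stable_poly n f \<longrightarrow> stable_poly n (symmetrizer G f)"
    and A: "A \<subseteq> {1..n}" and \<zeta>: "\<And>i. i \<in> {1..n} \<Longrightarrow> Im (\<zeta> i) > 0"
  shows "(\<Sum>\<sigma>\<in>G. prod \<zeta> (\<sigma> ` A)) \<noteq> 0"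
proof -
  define m :: monomial where "m = Abs_poly_mapping (\<lambda>i. if i \<in> A then 1 else 0)"
  have finA: "finite A" using A finite_subset by blast
  have lm: "Poly_Mapping.lookup m i = (if i \<in> A then 1 else 0)" for i
    unfolding m_def by (subst lookup_Abs_poly_mapping) (use finA in auto)
  have km: "Poly_Mapping.keys m = A" by (auto simp: in_keys_iff lm split: if_splits)
  define f :: mpoly where "f = Poly_Mapping.single m 1"
  have kf: "Poly_Mapping.keys f = {m}" by (simp add: f_def)
  have f: "f \<in> mpolys n" "multiaffine f"
    using A by (auto simp: mpolys_def multiaffine_def kf km lm)
  have "meval \<eta> f = prod \<eta> A" for \<eta>
    by (simp add: meval_multiaffine[OF f(2)] kf km) (simp add: f_def)
  then have "stable_poly n f"
    unfolding stable_poly_def using A finA by (fastforce simp: prod_zero_iff)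
  then have "stable_poly n (symmetrizer G f)" using assms(1) f by blast
  then have "meval \<zeta> (symmetrizer G f) \<noteq> 0" using \<zeta> by (simp add: stable_poly_def)
  then show ?thesis by (simp add: meval_symmetrizer_multiaffine[OF f(2)] kf km)
qed

definition same_orbit_counts :: "nat set \<Rightarrow> nat set \<Rightarrow> bool" where
  "same_orbit_counts A B \<longleftrightarrow> (\<forall>S\<in>orbs. card (A \<inter> S) = card (B \<inter> S))"

lemma same_orbit_counts_insert:
  assumes "S \<in> orbs" "a \<in> S" "b \<in> S" "a \<notin> C" "b \<notin> C"
  shows "same_orbit_counts (insert a C) (insert b C)"
  unfolding same_orbit_counts_def
proof
  fix T assume T: "T \<in> orbs"
  show "card (insert a C \<inter> T) = card (insert b C \<inter> T)"
  proof (cases "T = S")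
    case True
    then have "insert a C \<inter> T = insert a (C \<inter> T)" "insert b C \<inter> T = insert b (C \<inter> T)" using assms by auto
    then show ?thesis using assms finite_orbs(2)[OF T] by simp
  next
    case False
    then have "a \<notin> T" "b \<notin> T" using orbs_disjoint assms T by blast+
    then show ?thesis by simp
  qed
qed

lemma eq_if_Int_orbs_eq:
  assumes "A \<subseteq> {1..n}" "B \<subseteq> {1..n}" "\<And>S. S \<in> orbs \<Longrightarrow> A \<inter> S = B \<inter> S"
  shows "A = B"
proof -
  have "x \<in> A \<longleftrightarrow> x \<in> B" if x: "x \<in> {1..n}" for x
  proof -
    obtain S where "S \<in> orbs" "x \<in> S" using orb_exists[OF x] by (elim bexE)
    then show ?thesis using assms(3)[of S] by blast
  qed
  then show ?thesis using assms(1,2) by blast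
qed

lemma image_eq_sym:
  assumes "\<exists>\<sigma>\<in>G. \<sigma> ` A = B"
  shows "\<exists>\<sigma>\<in>G. \<sigma> ` B = A"
proof -
  obtain \<sigma> where \<sigma>: "\<sigma> \<in> G" "\<sigma> ` A = B" using assms by (elim bexE)
  have "inv' \<sigma> ` B = A"
    unfolding \<sigma>(2)[symmetric] by (rule image_inv_f_f[OF permutes_inj[OF permutes_elem[OF \<sigma>(1)]]])
  then show ?thesis using inv_in[OF \<sigma>(1)] by (rule bexI)
qed

lemma image_eq_trans:
  assumes "\<exists>\<sigma>\<in>G. \<sigma> ` A = B" "\<exists>\<tau>\<in>G. \<tau> ` B = C"
  shows "\<exists>\<sigma>\<in>G. \<sigma> ` A = C"
proof -
  obtain \<sigma> \<tau> where "\<sigma> \<in> G" "\<sigma> ` A = B" "\<tau> \<in> G" "\<tau> ` B = C" using assms by (elim bexE)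
  then have "(\<tau> \<circ> \<sigma>) ` A = C" by (simp only: image_comp[symmetric])
  then show ?thesis using comp_in[OF \<open>\<tau> \<in> G\<close> \<open>\<sigma> \<in> G\<close>] by (rule bexI)
qed

text \<open>Put \<open>z = \<sigma> c\<close>. Then \<sigma> maps
  \<open>insert a (insert c U)\<close> to \<open>insert b (insert z U)\<close>, so both sets belong
  to the same orbit of sets and \<open>stable_exchange\<close> can be applied to them.\<close>

lemma exchange_image:
  assumes stab: "\<forall>f \<in> mpolys n. multiaffine f \<and> stable_poly n f \<longrightarrow> stable_poly n (symmetrizer G f)"
    and sub: "insert a (insert b (insert c U)) \<subseteq> {1..n}"
    and dist: "distinct [a, b, c]" "U \<inter> {a, b, c} = {}"
    and \<sigma>: "\<sigma> \<in> G" "\<sigma> ` insert a U = insert b U"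
    and no: "\<not> (\<exists>\<sigma>\<in>G. \<sigma> ` insert a (insert c U) = insert b (insert c U))"
  shows "\<exists>\<sigma>\<in>G. \<sigma> ` insert a (insert c U) = insert a (insert b U)"
proof -
  define z where "z = \<sigma> c"
  let ?A = "insert a (insert c U)"
  have "\<sigma> ` ?A = insert z (\<sigma> ` insert a U)"
    unfolding z_def image_insert by (rule insert_commute)
  then have im: "\<sigma> ` ?A = insert b (insert z U)"
    unfolding \<sigma>(2) by (simp only: insert_commute)
  have "c \<notin> insert a U" using dist by auto
  then have "\<sigma> c \<notin> \<sigma> ` insert a U"
    by (simp only: inj_image_mem_iff[OF permutes_inj[OF permutes_elem[OF \<sigma>(1)]]] not_False_eq_True)
  then have z: "z \<notin> U" "z \<noteq> b" unfolding \<sigma>(2) z_def by auto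
  have zn: "z \<in> {1..n}"
    using permutes_in_image[OF permutes_elem[OF \<sigma>(1)]] sub by (simp add: z_def)
  have "z \<noteq> c"
  proof
    assume "z = c"
    with im have "\<sigma> ` ?A = insert b (insert c U)" by (simp only:)
    with no \<sigma>(1) show False by (elim notE) (rule bexI)
  qed
  show ?thesis
  \<comment> \<open>For \<open>z = a\<close> the image under \<sigma> is already the desired set.
    Otherwise \<open>a\<close>, \<open>b\<close>, \<open>c\<close>, \<open>z\<close> are distinct,
    as the exchange lemma requires.\<close>
  proof (cases "z = a")
    case True
    have "\<sigma> ` ?A = insert a (insert b U)" unfolding im True by (rule insert_commute)
    then show ?thesis using \<sigma>(1) by (rule bexI)
  next
    case False
    have finU: "finite U" using sub by (intro finite_subset[of U "{1..n}"]) auto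
    have "insert a (insert b U) \<in> (\<lambda>\<sigma>. \<sigma> ` ?A) ` G"
    proof (rule stable_exchange[where V = "{1..n}" and c = c and z = z])
      show "\<pi> ` ?A \<subseteq> {1..n}" if "\<pi> \<in> G" for \<pi>
        using permutes_in_image[OF permutes_elem[OF that]] sub by blast
      show "card (\<pi> ` ?A) = card U + 2" if "\<pi> \<in> G" for \<pi>
        unfolding card_image[OF inj_on_elem[OF that]] using finU dist by simp
      show "(\<Sum>\<sigma>\<in>G. prod \<zeta> (\<sigma> ` ?A)) \<noteq> 0" if "\<And>i. i \<in> {1..n} \<Longrightarrow> Im (\<zeta> i) > 0" for \<zeta>
        by (rule sum_monomial_images_nonzero[OF stab _ that]) (use sub in auto)
      show "insert b (insert z U) \<in> (\<lambda>\<sigma>. \<sigma> ` ?A) ` G"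
        using \<sigma>(1) by (rule rev_image_eqI) (rule im[symmetric])
      show "?A \<in> (\<lambda>\<sigma>. \<sigma> ` ?A) ` G"
        using id_in by (rule rev_image_eqI) (simp only: image_id id_apply)
      show "insert b (insert c U) \<notin> (\<lambda>\<sigma>. \<sigma> ` ?A) ` G"
      proof
        assume "insert b (insert c U) \<in> (\<lambda>\<sigma>. \<sigma> ` ?A) ` G"
        then obtain \<pi> where "insert b (insert c U) = \<pi> ` ?A" "\<pi> \<in> G" by (elim imageE)
        then show False using no by (elim notE) (rule bexI, rule sym)
      qed
      show "U \<inter> {a, b, c, z} = {}" using dist z(1) by auto
      show "distinct [a, b, c, z]" using dist z False \<open>z \<noteq> c\<close> by auto
      show "{a, b, c, z} \<subseteq> {1..n}" using sub zn by simp
      show "U \<subseteq> {1..n}" using sub by simp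
    qed (use finite_G in simp_all)
    then show ?thesis by (elim imageE) (rule bexI, rule sym)
  qed
qed

text \<open>The induction hypothesis concerns sets with one element less than those in the
  conclusion. If the conclusion failed, \<open>exchange_image\<close> would link
  \<open>insert a C\<close> and, with the roles of \<open>a\<close> and \<open>b\<close> swapped,
  \<open>insert b C\<close> to the same set \<open>insert a (insert b U)\<close>, hence to each
  other.\<close>

lemma adjacent_sets_equivalent:
  assumes stab: "\<forall>f \<in> mpolys n. multiaffine f \<and> stable_poly n f \<longrightarrow> stable_poly n (symmetrizer G f)"
    and IH: "\<And>A B. card A = card C \<Longrightarrow> A \<subseteq> {1..n} \<Longrightarrow> B \<subseteq> {1..n} \<Longrightarrow> same_orbit_counts A B \<Longrightarrow> \<exists>\<sigma>\<in>G. \<sigma> ` A = B"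
    and C: "C \<subseteq> {1..n}" "a \<notin> C" "b \<notin> C" "a \<noteq> b" and S: "S \<in> orbs" "a \<in> S" "b \<in> S"
  shows "\<exists>\<sigma>\<in>G. \<sigma> ` insert a C = insert b C"
proof (cases "C = {}")
  case True
  obtain y where "S = (\<lambda>\<sigma>. \<sigma> y) ` G" using S(1) by (auto simp: orbs_eq)
  then have "b \<in> (\<lambda>\<sigma>. \<sigma> a) ` G" using S orb_trans by metis
  then show ?thesis using True by auto
next
  case False
  then obtain c where c: "c \<in> C" by blast
  define U where "U = C - {c}"
  have CU: "C = insert c U" and cU: "c \<notin> U" using c by (auto simp: U_def)
  have finC: "finite C" using C finite_subset by blast
  have ab: "a \<in> {1..n}" "b \<in> {1..n}" using S orb_subset[OF S(1)] by auto
  \<comment> \<open>Formulated for \<open>p\<close> and \<open>q\<close> so that it serves both for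
    \<open>a\<close>, \<open>b\<close> and for \<open>b\<close>, \<open>a\<close>.\<close>
  have reach: "\<exists>\<sigma>\<in>G. \<sigma> ` insert p C = insert p (insert q U)"
    if pq: "{p, q} = {a, b}" "p \<noteq> q" and no: "\<not> (\<exists>\<sigma>\<in>G. \<sigma> ` insert p C = insert q C)" for p q
  proof -
    have p: "p \<in> S" "q \<in> S" "p \<notin> C" "q \<notin> C" "p \<in> {1..n}" "q \<in> {1..n}"
      using pq S C ab by (auto simp: doubleton_eq_iff)
    have "\<exists>\<sigma>\<in>G. \<sigma> ` insert p U = insert q U"
    proof (rule IH)
      show "card (insert p U) = card C"
        using p finC cU by (simp add: CU)
      show "same_orbit_counts (insert p U) (insert q U)"
        using p by (intro same_orbit_counts_insert[OF S(1)]) (auto simp: CU)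
    qed (use p C in \<open>auto simp: CU\<close>)
    then obtain \<sigma> where \<sigma>: "\<sigma> \<in> G" "\<sigma> ` insert p U = insert q U" by blast
    show ?thesis
      unfolding CU
    proof (rule exchange_image[OF stab _ _ _ \<sigma>])
      show "\<not> (\<exists>\<sigma>\<in>G. \<sigma> ` insert p (insert c U) = insert q (insert c U))"
        using no unfolding CU .
    qed (use p cU C pq(2) in \<open>auto simp: CU\<close>)
  qed
  show ?thesis
  proof (rule ccontr)
    assume no: "\<not> ?thesis"
    then have no': "\<not> (\<exists>\<sigma>\<in>G. \<sigma> ` insert b C = insert a C)"
      by (rule contrapos_nn) (rule image_eq_sym)
    have "\<exists>\<sigma>\<in>G. \<sigma> ` insert a C = insert a (insert b U)"
      by (rule reach[OF refl C(4) no])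
    moreover have "\<exists>\<sigma>\<in>G. \<sigma> ` insert b C = insert a (insert b U)"
      unfolding insert_commute[of a b] by (rule reach[OF insert_commute C(4)[symmetric] no'])
    ultimately have ?thesis by (rule image_eq_trans[OF _ image_eq_sym])
    with no show False by (rule notE)
  qed
qed

text \<open>The outer induction on the cardinality provides the hypothesis of
  \<open>adjacent_sets_equivalent\<close>. The inner one, on \<open>card (A - B)\<close> with
  \<open>B\<close> fixed, replaces one element of \<open>A\<close> by an element of \<open>B\<close>
  from the same orbit.\<close>

lemma same_orbit_counts_equivalent:
  assumes stab: "\<forall>f \<in> mpolys n. multiaffine f \<and> stable_poly n f \<longrightarrow> stable_poly n (symmetrizer G f)"
    and "A \<subseteq> {1..n}" "B \<subseteq> {1..n}" "same_orbit_counts A B"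
  shows "\<exists>\<sigma>\<in>G. \<sigma> ` A = B"
  using assms(2-)
proof (induction "card A" arbitrary: A B)
  case 0
  have "A = {}" using 0 finite_subset[of A "{1..n}"] by simp
  moreover have "A = B"
  proof (rule eq_if_Int_orbs_eq[OF 0(2,3)])
    fix S assume S: "S \<in> orbs"
    then have "card (B \<inter> S) = 0" using 0(4) \<open>A = {}\<close> by (simp add: same_orbit_counts_def)
    then show "A \<inter> S = B \<inter> S" using \<open>A = {}\<close> finite_orbs(2)[OF S] by simp
  qed
  ultimately show ?case using id_in by auto
next
  case (Suc k)
  note outer = Suc.hyps(1)
  have "\<exists>\<sigma>\<in>G. \<sigma> ` A = B" if "card A = Suc k" "A \<subseteq> {1..n}" "same_orbit_counts A B" for A
    using that
  proof (induction "card (A - B)" arbitrary: A rule: less_induct)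
    case less
    have fin: "finite A" using less.prems finite_subset by blast
    show ?case
    proof (cases "A = B")
      case True
      then show ?thesis using id_in by (metis image_id id_apply)
    next
      case False
      then obtain S where S: "S \<in> orbs" "A \<inter> S \<noteq> B \<inter> S"
        using eq_if_Int_orbs_eq[OF less.prems(2) Suc.prems(2)] by blast
      have fS: "finite S" by (rule finite_orbs(2)[OF S(1)])
      have cS: "card (A \<inter> S) = card (B \<inter> S)" using less.prems S by (simp add: same_orbit_counts_def)
      \<comment> \<open>The intersections with \<open>S\<close> differ but have the same finite
        cardinality, so neither contains the other.\<close>
      obtain a where a: "a \<in> A" "a \<notin> B" "a \<in> S"
        using card_subset_eq[of "B \<inter> S" "A \<inter> S"] fS cS S(2) by auto
      obtain b where b: "b \<in> B" "b \<notin> A" "b \<in> S"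
        using card_subset_eq[of "A \<inter> S" "B \<inter> S"] fS cS S(2) by auto
      define C where "C = A - {a}"
      have AC: "A = insert a C" "a \<notin> C" "b \<notin> C" using a b by (auto simp: C_def)
      have cC: "card C = k" using less.prems(1) a fin by (simp add: C_def)
      have ab: "a \<noteq> b" using a b by auto
      have st: "same_orbit_counts (insert a C) (insert b C)"
        by (rule same_orbit_counts_insert[OF S(1) a(3) b(3) AC(2,3)])
      have "\<exists>\<sigma>\<in>G. \<sigma> ` insert a C = insert b C"
      proof (rule adjacent_sets_equivalent[OF stab _ _ AC(2,3) ab S(1) a(3) b(3)])
        show "\<exists>\<sigma>\<in>G. \<sigma> ` X = Y" if "card X = card C" "X \<subseteq> {1..n}" "Y \<subseteq> {1..n}" "same_orbit_counts X Y" for X Y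
          using outer[of X Y] that cC by simp
        show "C \<subseteq> {1..n}" using less.prems AC by auto
      qed
      moreover have "\<exists>\<sigma>\<in>G. \<sigma> ` insert b C = B"
      proof (rule less.hyps)
        have "insert b C - B = (A - B) - {a}" using b by (auto simp: C_def)
        then show "card (insert b C - B) < card (A - B)"
          using a fin by (simp add: card_Diff1_less del: card_Diff_insert)
        show "card (insert b C) = Suc k"
          using AC fin cC by simp
        show "insert b C \<subseteq> {1..n}" using b Suc.prems(2) less.prems(2) AC by auto
        show "same_orbit_counts (insert b C) B"
          using st less.prems(3) AC(1) by (simp add: same_orbit_counts_def)
      qed
      ultimately show ?thesis unfolding AC(1) by (rule image_eq_trans)
    qed
  qed
  then show ?case using Suc by simp
qed

end

theorem theorem6:
  fixes n :: nat and G :: "(nat \<Rightarrow> nat) set"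
  assumes "n \<ge> 1" and "subgroup G (sym_group n)"
  shows "(\<forall>f \<in> mpolys n. multiaffine f \<and> stable_poly n f \<longrightarrow> stable_poly n (symmetrizer G f))
    \<longleftrightarrow> orbit_homogeneous n G"
proof -
  interpret permutation_group n G by (rule permutation_group.intro) (rule assms)
  show ?thesis
  proof
    assume stab: "\<forall>f \<in> mpolys n. multiaffine f \<and> stable_poly n f \<longrightarrow> stable_poly n (symmetrizer G f)"
    show "orbit_homogeneous n G"
      unfolding orbit_homogeneous_def
      using same_orbit_counts_equivalent[OF stab] unfolding same_orbit_counts_def by simp
  next
    assume "orbit_homogeneous n G"
    then show "\<forall>f \<in> mpolys n. multiaffine f \<and> stable_poly n f \<longrightarrow> stable_poly n (symmetrizer G f)"
      using stable_symmetrizer by blast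
  qed
qed

end
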